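(* There is an absolute constant $\gamma>0$ such that for every integer $k>500$ and every $\delta$ with $\ln^3 k/\sqrt{k}<\delta<1/100$, there exist a dimension $d$ and a finite data set (multiset) $X\subset\mathbb{R}^d$ such that for every threshold decision tree $\mathcal{T}$ with at most $(1+\delta)k$ leaves, $$\mathrm{cost}(X,\mathcal{T})\ge \gamma\,\frac{\log^2 k}{\delta}\,\mathrm{OPT}_k(X).$$
   Context: A threshold decision tree is a rooted binary tree whose nodes correspond to cells of $\mathbb{R}^d$: the root is $\mathbb{R}^d$, and each internal node $u$ is split by a cut $(i,\xi)$ into $\{y\in u: y_i\le\xi\}$ and $\{y\in u: y_i>\xi\}$. Its leaves partition $X$ into clusters; $\mathrm{cost}(X,\mathcal{T})$ is the sum over leaves of $\sum_{x}\|x-\mu\|_2^2$, where the inner sum is over points of $X$ in the leaf and $\mu$ is the centroid of those points. $\mathrm{OPT}_k(X)$ is the minimum over all choices of $k$ centers $c^1,\dots,c^k\in\mathbb{R}^d$ of $\sum_{x\in X}\min_j\|x-c^j\|_2^2$ (the optimal unconstrained $k$-means cost). *)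

theory Defs
  imports "HOL-Analysis.Analysis" "HOL-Library.Multiset"
begin

text \<open>Points of R^d are represented as functions nat => real; only the
coordinates 0..<d are relevant. Data sets are finite multisets of points.\<close>

type_synonym point = "nat \<Rightarrow> real"

definition sqdist :: "nat \<Rightarrow> point \<Rightarrow> point \<Rightarrow> real" where
  "sqdist d x y = (\<Sum>i<d. (x i - y i)^2)"

datatype thr_tree = Leaf | Node nat real thr_tree thr_tree

fun num_leaves :: "thr_tree \<Rightarrow> nat" where
  "num_leaves Leaf = 1"
| "num_leaves (Node i xi l r) = num_leaves l + num_leaves r"

fun valid_tree :: "nat \<Rightarrow> thr_tree \<Rightarrow> bool" where
  "valid_tree d Leaf = True"
| "valid_tree d (Node i xi l r) = (i < d \<and> valid_tree d l \<and> valid_tree d r)"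

fun clusters :: "thr_tree \<Rightarrow> point multiset \<Rightarrow> point multiset list" where
  "clusters Leaf X = [X]"
| "clusters (Node i xi l r) X =
     clusters l (filter_mset (\<lambda>y. y i \<le> xi) X) @ clusters r (filter_mset (\<lambda>y. y i > xi) X)"

definition centroid :: "point multiset \<Rightarrow> point" where
  "centroid C = (\<lambda>i. (\<Sum>x\<in>#C. x i) / real (size C))"

definition cluster_cost :: "nat \<Rightarrow> point multiset \<Rightarrow> real" where
  "cluster_cost d C = (\<Sum>x\<in>#C. sqdist d x (centroid C))"

definition tree_cost :: "nat \<Rightarrow> point multiset \<Rightarrow> thr_tree \<Rightarrow> real" where
  "tree_cost d X T = sum_list (map (cluster_cost d) (clusters T X))"

definition OPT :: "nat \<Rightarrow> nat \<Rightarrow> point multiset \<Rightarrow> real" where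
  "OPT d k X = Inf {(\<Sum>x\<in>#X. Min ((\<lambda>j. sqdist d x (c j)) ` {..<k})) | c :: nat \<Rightarrow> point. True}"

end

theory Submission
  imports Defs
begin

text \<open>Put \<open>L = ln k\<close>, \<open>N \<approx> L / (32 \<delta>)\<close>, \<open>d \<approx> 5 L\<close>, choose \<open>k\<close> centers uniformly at random in
  \<open>{0..<N}\<^sup>d\<close>, and let the data be the stars \<open>{v, v + e\<^sub>0, \<dots>, v + e\<^sub>d\<^sub>-\<^sub>1}\<close> around the centers, so
  that the optimum is at most \<open>d k\<close>. Two properties hold with positive probability: different
  stars are at squared distance of order \<open>d N\<^sup>2\<close>, and every box with \<open>m \<ge> \<surd>k\<close> centers has at least
  \<open>m / (4 N)\<close> of them in each layer \<open>v\<^sub>i = j\<close>, whose stars are broken by a cut at level \<open>j\<close>.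
  If the leaves isolate the stars, then the cells of the tree have total size of order \<open>k L\<close>, hence
  there are at least \<open>k + c k L / N \<ge> (1 + 2 \<delta>) k\<close> fragments of stars. With only \<open>(1 + \<delta>) k\<close> leaves
  of the order of \<open>\<delta> k\<close> fragments share a leaf with a different star and pay \<open>d N\<^sup>2\<close>, and
  \<open>\<delta> k d N\<^sup>2 / (d k)\<close> is of order \<open>L\<^sup>2 / \<delta>\<close>.\<close>

section \<open>Random centers\<close>

text \<open>Chernoff's bound in counting form: Markov's inequality for the exponential of the sum,
  whose total over the product space factors over the coordinates.\<close>

lemma card_PiE_exp_moment:
  fixes \<phi> :: "'i \<Rightarrow> 'v \<Rightarrow> real"
  assumes "finite I" "finite V"
    and mom: "\<And>i. i \<in> I \<Longrightarrow> (\<Sum>v\<in>V. exp (\<phi> i v)) \<le> real (card V)"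
  shows "real (card {f \<in> I \<rightarrow>\<^sub>E V. t \<le> (\<Sum>i\<in>I. \<phi> i (f i))}) \<le> exp (- t) * real (card V) ^ card I"
proof -
  let ?F = "I \<rightarrow>\<^sub>E V"
  let ?A = "{f \<in> ?F. t \<le> (\<Sum>i\<in>I. \<phi> i (f i))}"
  have fin: "finite ?F"
    using assms by (simp add: finite_PiE)
  have "real (card ?A) * exp t = (\<Sum>f\<in>?A. exp t)"
    by simp
  also have "\<dots> \<le> (\<Sum>f\<in>?A. exp (\<Sum>i\<in>I. \<phi> i (f i)))"
    by (rule sum_mono) auto
  also have "\<dots> \<le> (\<Sum>f\<in>?F. exp (\<Sum>i\<in>I. \<phi> i (f i)))"
    by (rule sum_mono2) (use fin in auto)
  also have "\<dots> = (\<Sum>f\<in>?F. \<Prod>i\<in>I. exp (\<phi> i (f i)))"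
    using \<open>finite I\<close> by (simp add: exp_sum)
  also have "\<dots> = (\<Prod>i\<in>I. \<Sum>v\<in>V. exp (\<phi> i v))"
    using assms by (subst prod_sum_PiE) auto
  also have "\<dots> \<le> (\<Prod>i\<in>I. real (card V))"
    by (rule prod_mono) (auto intro: sum_nonneg mom)
  finally have "real (card ?A) * exp t \<le> real (card V) ^ card I"
    by simp
  then show ?thesis
    by (simp add: exp_minus field_simps)
qed

text \<open>Fubini for counting: all coordinates but \<open>b\<close> are frozen. This reduces an
  event about a pair of centers to one about a single random point.\<close>

lemma card_PiE_le_coordinate:
  fixes q :: real
  assumes "finite I" "b \<in> I" "finite V"
    and fib: "\<And>g. g \<in> (I - {b}) \<rightarrow>\<^sub>E V \<Longrightarrow> real (card {y \<in> V. P (g(b := y))}) \<le> q * real (card V)"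
  shows "real (card {f \<in> I \<rightarrow>\<^sub>E V. P f}) \<le> q * real (card V) ^ card I"
proof -
  let ?G = "(I - {b}) \<rightarrow>\<^sub>E V"
  let ?S = "SIGMA g:?G. {y \<in> V. P (g(b := y))}"
  have fin: "finite ?G"
    using assms by (simp add: finite_PiE)
  have "{f \<in> I \<rightarrow>\<^sub>E V. P f} \<subseteq> (\<lambda>(g, y). g(b := y)) ` ?S"
  proof
    fix f assume f: "f \<in> {f \<in> I \<rightarrow>\<^sub>E V. P f}"
    have "f \<in> insert b (I - {b}) \<rightarrow>\<^sub>E V"
      using f \<open>b \<in> I\<close> by (simp add: insert_absorb)
    then have "f(b := undefined) \<in> ?G"
      by (intro fun_upd_in_PiE) auto
    moreover have "f b \<in> V"
      using f \<open>b \<in> I\<close> by auto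
    ultimately show "f \<in> (\<lambda>(g, y). g(b := y)) ` ?S"
      using f by (intro image_eqI[where x = "(f(b := undefined), f b)"]) auto
  qed
  moreover have finS: "finite ?S"
    using fin \<open>finite V\<close> by auto
  ultimately have "card {f \<in> I \<rightarrow>\<^sub>E V. P f} \<le> card ?S"
    by (meson card_image_le card_mono finite_imageI order_trans)
  also have "card ?S = (\<Sum>g\<in>?G. card {y \<in> V. P (g(b := y))})"
    using fin \<open>finite V\<close> by (subst card_SigmaI) auto
  finally have "real (card {f \<in> I \<rightarrow>\<^sub>E V. P f}) \<le> (\<Sum>g\<in>?G. real (card {y \<in> V. P (g(b := y))}))"
    by (simp flip: of_nat_sum)
  also have "\<dots> \<le> (\<Sum>g\<in>?G. q * real (card V))"
    by (rule sum_mono) (rule fib)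
  also have "\<dots> = q * (real (card V) * real (card V) ^ (card I - 1))"
    using assms by (simp add: card_funcsetE)
  also have "\<dots> = q * real (card V) ^ card I"
    using assms by (metis card_gt_0_iff empty_iff power_minus_mult mult.commute)
  finally show ?thesis .
qed

section \<open>Closeness of random grid points\<close>

definition close_coords :: "nat \<Rightarrow> nat \<Rightarrow> (nat \<Rightarrow> nat) \<Rightarrow> (nat \<Rightarrow> nat) \<Rightarrow> nat set" where
  "close_coords N d v w = {i \<in> {..<d}. \<bar>real (v i) - real (w i)\<bar> < real N / 20}"

text \<open>An interval of length \<open>N / 10\<close> contains at most \<open>N / 10 + 1\<close>
  integers, and the extra 1 is at most \<open>N / 10\<close>.\<close>

lemma card_near_nat_le:
  assumes "N \<ge> 10"
  shows "real (card {x \<in> {..<N}. \<bar>real x - a\<bar> < real N / 20}) \<le> real N / 5"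
proof -
  let ?r = "real N / 20"
  have sub: "int ` {x \<in> {..<N}. \<bar>real x - a\<bar> < ?r} \<subseteq> {\<lceil>a - ?r\<rceil>..\<lfloor>a + ?r\<rfloor>}"
    unfolding le_floor_iff ceiling_le_iff atLeastAtMost_iff image_subset_iff
    by (auto simp: abs_if split: if_splits)
  have "card {x \<in> {..<N}. \<bar>real x - a\<bar> < ?r} = card (int ` {x \<in> {..<N}. \<bar>real x - a\<bar> < ?r})"
    by (simp add: card_image)
  also have "\<dots> \<le> card {\<lceil>a - ?r\<rceil>..\<lfloor>a + ?r\<rfloor>}"
    using sub by (intro card_mono) auto
  finally have "real (card {x \<in> {..<N}. \<bar>real x - a\<bar> < ?r}) \<le> real (nat (\<lfloor>a + ?r\<rfloor> - \<lceil>a - ?r\<rceil> + 1))"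
    by simp
  also have "\<dots> \<le> 2 * ?r + 1"
  proof -
    have "of_int (\<lfloor>a + ?r\<rfloor> - \<lceil>a - ?r\<rceil> + 1) \<le> 2 * ?r + 1"
      using of_int_floor_le[of "a + ?r"] le_of_int_ceiling[of "a - ?r"]
      unfolding of_int_add of_int_diff of_int_1 by linarith
    then show ?thesis
      by (cases "\<lfloor>a + ?r\<rfloor> - \<lceil>a - ?r\<rceil> + 1 \<ge> 0") auto
  qed
  also have "\<dots> \<le> real N / 5"
    using assms by simp
  finally show ?thesis .
qed

lemma card_close_le:
  assumes N: "N \<ge> 10"
  shows "real (card {v \<in> {..<d} \<rightarrow>\<^sub>E {..<N}. 4 * card (close_coords N d v w) \<ge> 3 * d})
    \<le> (1/2) ^ d * real (card ({..<d} \<rightarrow>\<^sub>E {..<N}))"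
proof -
  define cl where "cl i = {x \<in> {..<N}. \<bar>real x - real (w i)\<bar> < real N / 20}" for i
  \<comment> \<open>A coordinate is close with probability at most 1/5, so the exponential moment is
    at most 4 * 1/5 + 1/4 * 4/5 = 1. If three quarters of the coordinates are close, the sum is at
    least \<open>ln 2 * d\<close>, which yields \<open>(1/2) ^ d\<close>.\<close>
  define \<phi> :: "nat \<Rightarrow> nat \<Rightarrow> real" where "\<phi> i x = (if x \<in> cl i then ln 4 else - ln 4)" for i x
  have mom: "(\<Sum>x<N. exp (\<phi> i x)) \<le> real (card {..<N})" for i
  proof -
    have cl: "real (card (cl i)) \<le> real N / 5" "cl i \<subseteq> {..<N}"
      using card_near_nat_le[OF N] by (auto simp: cl_def)
    have "exp (\<phi> i x) = 1/4 + (if x \<in> cl i then 15/4 else 0)" for x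
      by (auto simp: \<phi>_def exp_minus)
    then have "(\<Sum>x<N. exp (\<phi> i x)) = real N / 4 + 15/4 * real (card (cl i))"
      using cl(2) by (simp add: sum.distrib sum.If_cases Int_absorb1)
    also have "\<dots> \<le> real N"
      using cl by simp
    finally show ?thesis by simp
  qed
  have sum: "(\<Sum>i<d. \<phi> i (v i)) = ln 2 * (4 * real (card (close_coords N d v w)) - 2 * real d)"
    if "v \<in> {..<d} \<rightarrow>\<^sub>E {..<N}" for v
  proof -
    have "ln (4::real) = 2 * ln 2"
      using ln_realpow[of 2 2] by simp
    then have "\<phi> i (v i) = 4 * ln 2 * (if i \<in> close_coords N d v w then 1 else 0) - 2 * ln 2" if "i < d" for i
      using that \<open>v \<in> _\<close> by (auto simp: \<phi>_def cl_def close_coords_def PiE_iff)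
    then have "(\<Sum>i<d. \<phi> i (v i)) =
        (\<Sum>i<d. 4 * ln 2 * (if i \<in> close_coords N d v w then 1 else 0) - 2 * ln 2)"
      by (intro sum.cong) auto
    also have "\<dots> = 4 * ln 2 * real (card (close_coords N d v w)) - d * (2 * ln 2)"
    proof -
      have "{..<d} \<inter> close_coords N d v w = close_coords N d v w"
        by (auto simp: close_coords_def)
      then show ?thesis
        by (simp add: sum_subtractf sum.If_cases flip: sum_distrib_left)
    qed
    finally show ?thesis by (simp add: algebra_simps)
  qed
  have "{v \<in> {..<d} \<rightarrow>\<^sub>E {..<N}. 4 * card (close_coords N d v w) \<ge> 3 * d}
      \<subseteq> {v \<in> {..<d} \<rightarrow>\<^sub>E {..<N}. ln 2 * d \<le> (\<Sum>i<d. \<phi> i (v i))}"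
  proof clarify
    fix v assume v: "v \<in> {..<d} \<rightarrow>\<^sub>E {..<N}" and c: "3 * d \<le> 4 * card (close_coords N d v w)"
    have "real d \<le> 4 * real (card (close_coords N d v w)) - 2 * real d"
      using c by linarith
    then show "ln 2 * d \<le> (\<Sum>i<d. \<phi> i (v i))"
      unfolding sum[OF v] by (intro mult_left_mono) auto
  qed
  then have "card {v \<in> {..<d} \<rightarrow>\<^sub>E {..<N}. 4 * card (close_coords N d v w) \<ge> 3 * d}
      \<le> card {v \<in> {..<d} \<rightarrow>\<^sub>E {..<N}. ln 2 * d \<le> (\<Sum>i<d. \<phi> i (v i))}"
    by (intro card_mono) (auto simp: finite_PiE)
  also have "real \<dots> \<le> exp (- (ln 2 * d)) * real (card {..<N}) ^ card {..<d}"
    by (rule card_PiE_exp_moment) (use mom in auto)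
  also have "exp (- (ln 2 * real d)) = (1/2) ^ d"
    by (simp add: exp_minus exp_of_nat2_mult power_one_over inverse_eq_divide)
  finally show ?thesis
    by (simp add: card_funcsetE)
qed

text \<open>The test function charges \<open>1/(2N)\<close> for each sample in \<open>B\<close> and refunds \<open>1\<close> for
  each sample in the layer; its exponential moment is at most \<open>1\<close> because the layer
  occupies at least a fraction \<open>1/N\<close> of \<open>B\<close>.\<close>
lemma card_thin_layer_le:
  assumes V: "finite V" "B \<subseteq> V" "C \<subseteq> B" and N: "N > 0" and CB: "card B \<le> N * card C"
  shows "real (card {f \<in> {..<k::nat} \<rightarrow>\<^sub>E V. M \<le> real (card {c\<in>{..<k}. f c \<in> B}) \<and>
            4 * real N * real (card {c\<in>{..<k}. f c \<in> C}) < real (card {c\<in>{..<k}. f c \<in> B})})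
    \<le> exp (- (M / (4 * real N))) * real (card V) ^ k"
proof -
  define s where "s = 1 / (2 * real N)"
  define \<phi> where "\<phi> v = s * indicator B v - indicator C v" for v
  have fin: "finite B" "finite C"
    using V finite_subset[of B V] finite_subset[of C B] by auto
  have s: "s > 0" "s * real N = 1/2"
    using N by (auto simp: s_def)
  have "(\<Sum>v\<in>V. exp (\<phi> v)) \<le> real (card V)"
  proof -
    \<comment> \<open>Since \<open>C \<subseteq> B\<close>, the exponent is 0 outside
      \<open>B\<close>, \<open>s\<close> on \<open>B - C\<close> and \<open>s - 1\<close> on
      \<open>C\<close>.\<close>
    have eq: "exp (\<phi> v) = 1 + (exp s - 1) * indicator B v - (exp s * (1 - exp (-1))) * indicator C v" for v
      using V by (auto simp: \<phi>_def indicator_def exp_diff exp_minus field_simps)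
    have ind: "sum (indicat_real S) V = card S" if "S \<subseteq> V" for S
      using V(1) that by (simp add: indicator_def Int_absorb1)
    have "(\<Sum>v\<in>V. exp (\<phi> v)) = card V + (exp s - 1) * card B - (exp s * (1 - exp (-1))) * card C"
      using V by (simp add: eq sum.distrib sum_subtractf ind flip: sum_distrib_left)
    moreover have "(exp s - 1) * card B \<le> (exp s * (1 - exp (-1))) * card C"
    proof -
      have "1 - s \<le> exp (- s)"
        using exp_ge_add_one_self[of "- s"] by simp
      then have "exp s * (1 - s) \<le> exp s * exp (- s)"
        by (intro mult_left_mono) auto
      also have "exp s * exp (- s) = 1"
        by (simp flip: exp_add)
      finally have 1: "exp s - 1 \<le> exp s * s"
        by (simp add: algebra_simps)
      have "2 \<le> exp (1::real)"
        using exp_ge_add_one_self[of 1] by simp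
      then have 2: "1/2 \<le> 1 - exp (-1::real)"
        by (simp add: exp_minus field_simps)
      have "(exp s - 1) * card B \<le> (exp s * s) * (N * card C)"
        using CB s 1 by (intro mult_mono) (auto simp flip: of_nat_mult)
      also have "\<dots> = exp s * (1/2) * card C"
        using s(2) by (simp add: mult.assoc mult.left_commute[of s])
      also have "\<dots> \<le> exp s * (1 - exp (-1)) * card C"
        using 2 by (intro mult_right_mono mult_left_mono) auto
      finally show ?thesis .
    qed
    ultimately show ?thesis by linarith
  qed
  then have mom: "real (card {f \<in> {..<k} \<rightarrow>\<^sub>E V. M / (4 * real N) \<le> (\<Sum>c<k. \<phi> (f c))})
      \<le> exp (- (M / (4 * real N))) * real (card V) ^ k"
    using card_PiE_exp_moment[of "{..<k}" V "\<lambda>_. \<phi>" "M / (4 * real N)"] V by simp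
  have sum: "(\<Sum>c<k. \<phi> (f c)) = s * card {c\<in>{..<k}. f c \<in> B} - card {c\<in>{..<k}. f c \<in> C}" for f
  proof -
    have ind: "(\<Sum>c<k. indicator S (f c)) = real (card {c\<in>{..<k}. f c \<in> S})" for S
      by (simp add: indicator_def Collect_conj_eq lessThan_def)
    show ?thesis
      by (simp add: \<phi>_def sum_subtractf ind flip: sum_distrib_left)
  qed
  have "{f \<in> {..<k} \<rightarrow>\<^sub>E V. M \<le> real (card {c\<in>{..<k}. f c \<in> B}) \<and>
      4 * real N * real (card {c\<in>{..<k}. f c \<in> C}) < real (card {c\<in>{..<k}. f c \<in> B})}
    \<subseteq> {f \<in> {..<k} \<rightarrow>\<^sub>E V. M / (4 * real N) \<le> (\<Sum>c<k. \<phi> (f c))}"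
  proof clarify
    fix f assume "M \<le> real (card {c\<in>{..<k}. f c \<in> B})"
      "4 * real N * real (card {c\<in>{..<k}. f c \<in> C}) < real (card {c\<in>{..<k}. f c \<in> B})"
    moreover define m n where "m = real (card {c\<in>{..<k}. f c \<in> B})"
      and "n = real (card {c\<in>{..<k}. f c \<in> C})"
    ultimately have "M \<le> m" "4 * real N * n < m"
      by auto
    then have "M / (4 * real N) \<le> m / (4 * real N)" "n \<le> m / (4 * real N)"
      using N by (auto simp: divide_right_mono pos_le_divide_eq mult.commute)
    \<comment> \<open>Half of the charge covers the refund \<open>n\<close>; the other half reaches
      the threshold because \<open>M \<le> m\<close>.\<close>
    moreover have "s * m = m / (4 * real N) + m / (4 * real N)"
      by (simp add: s_def)
    ultimately show "M / (4 * real N) \<le> (\<Sum>c<k. \<phi> (f c))"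
      unfolding sum m_def n_def by linarith
  qed
  moreover have "finite {f \<in> {..<k} \<rightarrow>\<^sub>E V. M / (4 * real N) \<le> (\<Sum>c<k. \<phi> (f c))}"
    using V(1) by (simp add: finite_PiE)
  ultimately show ?thesis
    using mom by (meson card_mono of_nat_mono order_trans)
qed

section \<open>Integer boxes, their layers and the union bound\<close>

definition nat_box :: "nat \<Rightarrow> (nat \<Rightarrow> nat) \<Rightarrow> (nat \<Rightarrow> nat) \<Rightarrow> (nat \<Rightarrow> nat) set" where
  "nat_box d lo hi = {v. \<forall>i<d. lo i \<le> v i \<and> v i \<le> hi i}"

text \<open>Moving a point into the layer and remembering its old \<open>i\<close>-th coordinate is
  injective, and there are at most \<open>N\<close> values to remember.\<close>

lemma card_box_le_layer:
  assumes "i < d" "lo i \<le> j" "j \<le> hi i" "j < N"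
  defines "B \<equiv> ({..<d} \<rightarrow>\<^sub>E {..<N}) \<inter> nat_box d lo hi"
  shows "card B \<le> N * card {v \<in> B. v i = j}"
proof -
  let ?C = "{v \<in> B. v i = j}"
  let ?h = "\<lambda>v. (v(i := j), v i)"
  have fin: "finite B"
    by (simp add: B_def finite_PiE)
  have "inj_on ?h B"
    by (auto intro!: inj_onI simp: fun_eq_iff split: if_splits)
  moreover have "?h ` B \<subseteq> ?C \<times> {..<N}"
  proof safe
    fix v assume v: "v \<in> B"
    then have "v(i := j) \<in> insert i {..<d} \<rightarrow>\<^sub>E {..<N}"
      using assms by (intro PiE_fun_upd) auto
    then show "v(i := j) \<in> B"
      using v assms by (auto simp: B_def nat_box_def insert_absorb)
  qed (use assms in \<open>auto simp: B_def\<close>)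
  ultimately have "card B \<le> card (?C \<times> {..<N})"
    using fin by (intro card_inj_on_le[of ?h]) auto
  then show ?thesis
    by (simp add: card_cartesian_product mult.commute)
qed

text \<open>Union bound over at most \<open>k ^ 2\<close> pairs of centers and at most
  \<open>d * N * (N + 1) ^ (2 * d)\<close> choices of two corners, a coordinate and a level. As all
  corners with entries up to \<open>N\<close> are covered, one choice of centers serves every cell
  of every tree.\<close>

lemma ex_spread_centers:
  assumes N: "N \<ge> 10"
    and num: "real k ^ 2 * (1/2) ^ d +
      real d * real N * real (N + 1) ^ (2 * d) * exp (- (M / (4 * real N))) < 1"
  obtains v :: "nat \<Rightarrow> nat \<Rightarrow> nat" where
    "\<And>c i. c < k \<Longrightarrow> i < d \<Longrightarrow> v c i < N"
    "\<And>a b. a < k \<Longrightarrow> b < k \<Longrightarrow> a \<noteq> b \<Longrightarrow> 4 * card (close_coords N d (v a) (v b)) < 3 * d"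
    "\<And>lo hi i j. lo \<in> {..<d} \<rightarrow>\<^sub>E {..N} \<Longrightarrow> hi \<in> {..<d} \<rightarrow>\<^sub>E {..N} \<Longrightarrow> i < d \<Longrightarrow> lo i \<le> j \<Longrightarrow> j < hi i \<Longrightarrow>
       M \<le> real (card {c\<in>{..<k}. v c \<in> nat_box d lo hi}) \<Longrightarrow>
       real (card {c\<in>{..<k}. v c \<in> nat_box d lo hi})
         \<le> 4 * real N * real (card {c\<in>{..<k}. v c \<in> nat_box d lo hi \<and> v c i = j})"
proof -
  define V where "V = {..<d} \<rightarrow>\<^sub>E {..<N}"
  define F where "F = {..<k} \<rightarrow>\<^sub>E V"
  define P where "P = {..<d} \<rightarrow>\<^sub>E {..N}"
  define Q where "Q = {(a, b). a < k \<and> b < k \<and> a \<noteq> b}"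
  define R where "R = {(lo, hi, i, j). lo \<in> P \<and> hi \<in> P \<and> i < d \<and> lo i \<le> j \<and> j < hi i}"
  define bad1 where "bad1 = (\<lambda>(a, b). {f \<in> F. 3 * d \<le> 4 * card (close_coords N d (f a) (f b))})"
  define bad2 where "bad2 = (\<lambda>(lo, hi, i, j). {f \<in> F.
      M \<le> real (card {c\<in>{..<k}. f c \<in> nat_box d lo hi}) \<and>
      4 * real N * real (card {c\<in>{..<k}. f c \<in> nat_box d lo hi \<and> f c i = j})
         < real (card {c\<in>{..<k}. f c \<in> nat_box d lo hi})})"
  have finV: "finite V" and finP: "finite P"
    by (auto simp: V_def P_def finite_PiE)
  then have finF: "finite F"
    by (auto simp: F_def finite_PiE)
  have cardF: "real (card F) = real (card V) ^ k"
    by (simp add: F_def card_funcsetE)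
  have posF: "card F > 0"
    using N by (simp add: F_def V_def card_funcsetE)
  have Q: "Q \<subseteq> {..<k} \<times> {..<k}"
    by (auto simp: Q_def)
  then have finQ: "finite Q"
    by (rule finite_subset) simp
  have cardQ: "card Q \<le> k ^ 2"
    using card_mono[OF _ Q] by (simp add: power2_eq_square)
  have R: "R \<subseteq> P \<times> P \<times> {..<d} \<times> {..<N}"
  proof
    fix r assume "r \<in> R"
    then obtain lo hi i j where r: "r = (lo, hi, i, j)" "lo \<in> P" "hi \<in> P" "i < d" "j < hi i"
      by (auto simp: R_def)
    then have "hi i \<le> N"
      by (auto simp: P_def)
    then show "r \<in> P \<times> P \<times> {..<d} \<times> {..<N}"
      using r by auto
  qed
  have finR: "finite R"
    by (rule finite_subset[OF R]) (use finP in simp)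
  have cardR: "card R \<le> d * N * (N + 1) ^ (2 * d)"
  proof -
    have "card R \<le> card (P \<times> P \<times> {..<d} \<times> {..<N})"
      using R finP by (intro card_mono) auto
    also have "\<dots> = d * N * (N + 1) ^ (2 * d)"
      by (simp add: card_cartesian_product P_def card_funcsetE mult_2 power_add)
    finally show ?thesis .
  qed
  have bad1: "real (card (bad1 q)) \<le> (1/2) ^ d * real (card F)" if "q \<in> Q" for q
  proof -
    obtain a b where q: "q = (a, b)" "a < k" "b < k" "a \<noteq> b"
      using \<open>q \<in> Q\<close> by (auto simp: Q_def)
    \<comment> \<open>Only \<open>f a\<close> is random here; \<open>f b\<close> is frozen and plays
      the part of \<open>w\<close> in \<open>card_close_le\<close>.\<close>
    have "real (card {f \<in> {..<k} \<rightarrow>\<^sub>E V. 3 * d \<le> 4 * card (close_coords N d (f a) (f b))})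
        \<le> (1/2) ^ d * real (card V) ^ card {..<k}"
      using card_PiE_le_coordinate[of "{..<k}" a V "\<lambda>f. 3 * d \<le> 4 * card (close_coords N d (f a) (f b))" "(1/2) ^ d"]
        q finV card_close_le[OF N, of d, folded V_def] by simp
    then show ?thesis
      by (simp add: bad1_def q(1) cardF F_def[symmetric])
  qed
  have bad2: "real (card (bad2 r)) \<le> exp (- (M / (4 * real N))) * real (card F)" if "r \<in> R" for r
  proof -
    obtain lo hi i j where r: "r = (lo, hi, i, j)" and l: "lo \<in> P" "hi \<in> P" "i < d" "lo i \<le> j" "j < hi i"
      using \<open>r \<in> R\<close> by (auto simp: R_def)
    define B where "B = V \<inter> nat_box d lo hi"
    have "j < N"
      using R that r by auto
    have "card B \<le> N * card {v \<in> B. v i = j}"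
      unfolding B_def V_def by (rule card_box_le_layer) (use l \<open>j < N\<close> in auto)
    then have "real (card {f \<in> {..<k} \<rightarrow>\<^sub>E V. M \<le> real (card {c\<in>{..<k}. f c \<in> B}) \<and>
            4 * real N * real (card {c\<in>{..<k}. f c \<in> {v \<in> B. v i = j}})
              < real (card {c\<in>{..<k}. f c \<in> B})})
        \<le> exp (- (M / (4 * real N))) * real (card V) ^ k"
      by (intro card_thin_layer_le) (use finV N in \<open>auto simp: B_def\<close>)
    also have "{f \<in> {..<k} \<rightarrow>\<^sub>E V. M \<le> real (card {c\<in>{..<k}. f c \<in> B}) \<and>
            4 * real N * real (card {c\<in>{..<k}. f c \<in> {v \<in> B. v i = j}})
              < real (card {c\<in>{..<k}. f c \<in> B})} = bad2 r"
    proof -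
      have 1: "{c\<in>{..<k}. f c \<in> B} = {c\<in>{..<k}. f c \<in> nat_box d lo hi}" if "f \<in> F" for f
        using that by (auto simp: B_def F_def)
      have 2: "{c\<in>{..<k}. f c \<in> {v \<in> B. v i = j}} = {c\<in>{..<k}. f c \<in> nat_box d lo hi \<and> f c i = j}"
        if "f \<in> F" for f
        using that by (auto simp: B_def F_def)
      show ?thesis
        unfolding bad2_def r prod.case F_def[symmetric]
        by (intro Collect_cong conj_cong refl) (simp_all only: 1 2)
    qed
    finally show ?thesis
      by (simp add: cardF)
  qed
  have "\<exists>f\<in>F. f \<notin> (\<Union>q\<in>Q. bad1 q) \<union> (\<Union>r\<in>R. bad2 r)"
  proof (rule ccontr)
    assume "\<not> ?thesis"
    then have sub: "F \<subseteq> (\<Union>q\<in>Q. bad1 q) \<union> (\<Union>r\<in>R. bad2 r)"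
      by blast
    have finbad: "finite (bad1 q)" "finite (bad2 r)" for q r
      using finF by (auto simp: bad1_def bad2_def split: prod.splits)
    have "card F \<le> card ((\<Union>q\<in>Q. bad1 q) \<union> (\<Union>r\<in>R. bad2 r))"
      using sub finQ finR finbad by (intro card_mono) auto
    also have "\<dots> \<le> card (\<Union>q\<in>Q. bad1 q) + card (\<Union>r\<in>R. bad2 r)"
      by (rule card_Un_le)
    also have "\<dots> \<le> (\<Sum>q\<in>Q. card (bad1 q)) + (\<Sum>r\<in>R. card (bad2 r))"
      by (intro add_mono card_UN_le finQ finR)
    finally have "real (card F) \<le> (\<Sum>q\<in>Q. real (card (bad1 q))) + (\<Sum>r\<in>R. real (card (bad2 r)))"
      by (simp flip: of_nat_sum of_nat_add)
    also have "\<dots> \<le> (\<Sum>q\<in>Q. (1/2) ^ d * real (card F)) + (\<Sum>r\<in>R. exp (- (M / (4 * real N))) * real (card F))"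
      by (intro add_mono sum_mono bad1 bad2)
    also have "\<dots> = (real (card Q) * (1/2) ^ d + real (card R) * exp (- (M / (4 * real N)))) * real (card F)"
      by (simp add: algebra_simps)
    also have "\<dots> \<le> (real (k ^ 2) * (1/2) ^ d + real (d * N * (N + 1) ^ (2 * d)) * exp (- (M / (4 * real N)))) * real (card F)"
      by (intro mult_right_mono add_mono of_nat_mono cardQ cardR) auto
    also have "\<dots> < 1 * real (card F)"
      using num posF by (intro mult_strict_right_mono) (auto simp: mult.assoc)
    finally show False by simp
  qed
  then obtain v where v: "v \<in> F" "\<And>q. q \<in> Q \<Longrightarrow> v \<notin> bad1 q" "\<And>r. r \<in> R \<Longrightarrow> v \<notin> bad2 r"
    by blast
  show thesis
  proof
    show "v c i < N" if "c < k" "i < d" for c i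
      using v(1) that by (auto simp: F_def V_def PiE_iff)
    show "4 * card (close_coords N d (v a) (v b)) < 3 * d" if "a < k" "b < k" "a \<noteq> b" for a b
      using v(2)[of "(a, b)"] v(1) that by (auto simp: Q_def bad1_def)
    fix lo hi i j
    assume "lo \<in> {..<d} \<rightarrow>\<^sub>E {..N}" "hi \<in> {..<d} \<rightarrow>\<^sub>E {..N}" "i < d" "lo i \<le> j" "j < hi i"
      "M \<le> real (card {c\<in>{..<k}. v c \<in> nat_box d lo hi})"
    then show "real (card {c\<in>{..<k}. v c \<in> nat_box d lo hi})
         \<le> 4 * real N * real (card {c\<in>{..<k}. v c \<in> nat_box d lo hi \<and> v c i = j})"
      using v(3)[of "(lo, hi, i, j)"] v(1) by (auto simp: R_def P_def bad2_def not_less)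
  qed
qed

section \<open>Cost of clusters and trees\<close>

lemma sqdist_nonneg: "0 \<le> sqdist d x y"
  by (simp add: sqdist_def sum_nonneg)

lemma sqdist_le_twice: "sqdist d x y \<le> 2 * sqdist d x z + 2 * sqdist d y z"
proof -
  have "(x i - y i)\<^sup>2 \<le> 2 * (x i - z i)\<^sup>2 + 2 * (y i - z i)\<^sup>2" for i
    using zero_le_power2[of "(x i - z i) + (y i - z i)"] by (simp add: power2_eq_square algebra_simps)
  then show ?thesis
    by (simp add: sqdist_def sum_distrib_left sum_mono flip: sum.distrib)
qed

lemma sum_mset_nonneg:
  fixes f :: "'a \<Rightarrow> 'b :: ordered_comm_monoid_add"
  assumes "\<And>x. x \<in># A \<Longrightarrow> 0 \<le> f x"
  shows "0 \<le> (\<Sum>x\<in>#A. f x)"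
  using assms by (induction A) auto

lemma cluster_cost_nonneg: "0 \<le> cluster_cost d C"
  by (auto simp: cluster_cost_def intro!: sum_mset_nonneg sqdist_nonneg)

lemma tree_cost_Leaf: "tree_cost d C Leaf = cluster_cost d C"
  and tree_cost_Node: "tree_cost d C (Node i xi l r) =
    tree_cost d (filter_mset (\<lambda>y. y i \<le> xi) C) l + tree_cost d (filter_mset (\<lambda>y. y i > xi) C) r"
  by (simp_all add: tree_cost_def)

lemma tree_cost_nonneg: "0 \<le> tree_cost d C T"
  by (auto simp: tree_cost_def intro!: sum_list_nonneg cluster_cost_nonneg)

text \<open>At most one representative can be within squared distance \<open>D/4\<close> of the centroid.\<close>
lemma cluster_cost_ge:
  assumes A: "finite A" and mem: "\<And>a. a \<in> A \<Longrightarrow> r a \<in># C" and "D > 0"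
    and sep: "\<And>a b. a \<in> A \<Longrightarrow> b \<in> A \<Longrightarrow> a \<noteq> b \<Longrightarrow> D \<le> sqdist d (r a) (r b)"
  shows "D / 4 * (real (card A) - 1) \<le> cluster_cost d C"
proof -
  let ?f = "\<lambda>x. sqdist d x (centroid C)"
  \<comment> \<open>If no representative is close to the centroid, any \<open>a0\<close> will do,
    even one outside \<open>A\<close>.\<close>
  obtain a0 where a0: "\<And>a. a \<in> A - {a0} \<Longrightarrow> D / 4 \<le> ?f (r a)"
  proof (cases "\<exists>a\<in>A. ?f (r a) < D / 4")
    case True
    then obtain a0 where a0: "a0 \<in> A" "?f (r a0) < D / 4" by blast
    have "D / 4 \<le> ?f (r a)" if "a \<in> A - {a0}" for a
      using sep[of a a0] sqdist_le_twice[of d "r a" "r a0" "centroid C"] a0 that by auto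
    then show thesis by (rule that)
  next
    case False
    then show thesis by (intro that) force
  qed
  have inj: "inj_on r A"
    using sep \<open>D > 0\<close> by (intro inj_onI) (force simp: sqdist_def)
  have "real (card A) - 1 \<le> real (card (A - {a0}))"
    using A by (cases "a0 \<in> A") auto
  then have "D / 4 * (real (card A) - 1) \<le> D / 4 * real (card (A - {a0}))"
    using \<open>D > 0\<close> by (intro mult_left_mono) auto
  also have "\<dots> = (\<Sum>a\<in>A - {a0}. D / 4)"
    by simp
  also have "\<dots> \<le> (\<Sum>a\<in>A - {a0}. ?f (r a))"
    by (intro sum_mono a0)
  also have "\<dots> \<le> (\<Sum>a\<in>A. ?f (r a))"
    using A by (intro sum_mono2) (auto simp: sqdist_nonneg)
  also have "\<dots> = (\<Sum>x\<in>r ` A. ?f x)"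
    using inj by (simp add: sum.reindex)
  also have "\<dots> \<le> (\<Sum>x\<in>set_mset C. ?f x)"
    using mem by (intro sum_mono2) (auto simp: sqdist_nonneg)
  also have "\<dots> = (\<Sum>x\<in>#mset_set (set_mset C). ?f x)"
    by (rule sum_unfold_sum_mset)
  also have "\<dots> \<le> (\<Sum>x\<in>#C. ?f x)"
  proof -
    obtain R where "C = mset_set (set_mset C) + R"
      using mset_set_set_mset_msubset by (metis mset_subset_eq_exists_conv)
    then have "(\<Sum>x\<in>#C. ?f x) = (\<Sum>x\<in>#mset_set (set_mset C). ?f x) + (\<Sum>x\<in>#R. ?f x)"
      by (metis image_mset_union sum_mset.union)
    moreover have "0 \<le> (\<Sum>x\<in>#R. ?f x)"
      by (auto intro!: sum_mset_nonneg sqdist_nonneg)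
    ultimately show ?thesis by simp
  qed
  finally show ?thesis
    by (simp add: cluster_cost_def)
qed

section \<open>The entropy potential\<close>

text \<open>An unnormalised entropy: it bounds from below the total size of the cells met while
  splitting a set of size \<open>x\<close> into pieces smaller than \<open>M\<close>. It is
  truncated because the layer property concerns only boxes with at least \<open>M\<close>
  centers.\<close>

definition trunc_xlog :: "real \<Rightarrow> real \<Rightarrow> real" where
  "trunc_xlog M x = (if M \<le> x then x * ln (x / M) else 0)"

text \<open>By \<open>ln t \<le> t - 1\<close> at \<open>t = (x + y) / z\<close>, replacing
  \<open>x + y\<close> by a part \<open>z\<close> inside the logarithm loses at most
  \<open>x + y - z\<close>. The losses for \<open>z = x\<close> and \<open>z = y\<close> add up to
  \<open>x + y\<close>.\<close>

lemma trunc_xlog_split: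
  assumes "M > 0" "x \<ge> 0" "y \<ge> 0"
  shows "trunc_xlog M (x + y) \<le> trunc_xlog M x + trunc_xlog M y + (if M \<le> x + y then x + y else 0)"
proof (cases "M \<le> x + y")
  case True
  let ?m = "x + y"
  have *: "z * ln (?m / M) \<le> trunc_xlog M z + (?m - z)" if "0 \<le> z" "z \<le> ?m" for z
  proof (cases "z = 0")
    case True
    then show ?thesis
      using assms by (simp add: trunc_xlog_def)
  next
    case False
    then have z: "z > 0" "?m > 0" using that by auto
    have "ln (?m / z) \<le> ?m / z - 1"
      using z by (intro ln_le_minus_one) auto
    then have "z * ln (?m / z) \<le> z * (?m / z - 1)"
      using z by (intro mult_left_mono) auto
    also have "\<dots> = ?m - z"
      using z by (simp add: field_simps)
    finally have 1: "z * ln (?m / z) \<le> ?m - z" .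
    have "ln (?m / M) = ln (?m / z) + ln (z / M)"
      using z assms(1) by (simp add: ln_div)
    then have 2: "z * ln (?m / M) = z * ln (?m / z) + z * ln (z / M)"
      by (simp add: distrib_left)
    have "z * ln (z / M) \<le> trunc_xlog M z"
      using z assms(1) by (auto simp: trunc_xlog_def mult_le_0_iff)
    then show ?thesis using 1 2 by linarith
  qed
  have "trunc_xlog M ?m = x * ln (?m / M) + y * ln (?m / M)"
    using True by (simp add: trunc_xlog_def algebra_simps)
  then show ?thesis
    using *[of x] *[of y] True assms by simp
next
  case False
  then show ?thesis
    using assms by (simp add: trunc_xlog_def)
qed

section \<open>The data set of stars\<close>

text \<open>What the deterministic argument needs from the random centers. \<open>N \<ge> 40\<close>
  lets the scale \<open>N / 40\<close> absorb the unit shifts in a star, and the bound on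
  \<open>ln (real k / M)\<close> lets a leaf pay for its entropy term.\<close>

locale spread_centers =
  fixes d N k :: nat and M :: real and v :: "nat \<Rightarrow> nat \<Rightarrow> nat"
  assumes N: "N \<ge> 40" and d: "d > 0" and k: "k > 0"
    and M: "M \<ge> 2" "M \<le> real k" "ln (real k / M) \<le> 2 * real N"
    and range: "\<And>c i. c < k \<Longrightarrow> i < d \<Longrightarrow> v c i < N"
    and spread: "\<And>a b. a < k \<Longrightarrow> b < k \<Longrightarrow> a \<noteq> b \<Longrightarrow> 4 * card (close_coords N d (v a) (v b)) < 3 * d"
    and layer: "\<And>lo hi i j. lo \<in> {..<d} \<rightarrow>\<^sub>E {..N} \<Longrightarrow> hi \<in> {..<d} \<rightarrow>\<^sub>E {..N} \<Longrightarrow> i < d \<Longrightarrow> lo i \<le> j \<Longrightarrow> j < hi i \<Longrightarrow>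
       M \<le> real (card {c\<in>{..<k}. v c \<in> nat_box d lo hi}) \<Longrightarrow>
       real (card {c\<in>{..<k}. v c \<in> nat_box d lo hi})
         \<le> 4 * real N * real (card {c\<in>{..<k}. v c \<in> nat_box d lo hi \<and> v c i = j})"
begin

definition pt :: "nat \<Rightarrow> point" where
  "pt c = (\<lambda>i. real (v c i))"

text \<open>All shifts go upwards, so a cut of coordinate \<open>i\<close> at a threshold in
  \<open>[j, j + 1)\<close> separates a center with \<open>v c i = j\<close> from its
  \<open>i\<close>-th shift.\<close>

definition star :: "nat \<Rightarrow> point set" where
  "star c = insert (pt c) ((\<lambda>i. (pt c)(i := pt c i + 1)) ` {..<d})"

definition points :: "point set" where
  "points = (\<Union>c<k. star c)"

definition D :: real where
  "D = real d * real N ^ 2 / 6400"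

definition frag :: "point multiset \<Rightarrow> nat set" where
  "frag C = {c \<in> {..<k}. \<exists>y\<in>star c. y \<in># C}"

text \<open>Only the center of the star has to lie in \<open>C\<close>. This count is therefore
  additive under cuts, whereas the total of \<open>card (frag C)\<close> grows when a star is
  broken.\<close>

definition whole :: "point multiset \<Rightarrow> nat set" where
  "whole C = {c \<in> {..<k}. pt c \<in># C}"

definition cell :: "(nat \<Rightarrow> nat) \<Rightarrow> (nat \<Rightarrow> nat) \<Rightarrow> point multiset" where
  "cell lo hi = {#y \<in># mset_set points. \<forall>i<d. real (lo i) \<le> y i \<and> y i \<le> real (hi i)#}"

lemma D_ge: "D \<ge> 1/4"
proof -
  have "1 * 40 ^ 2 \<le> real d * real N ^ 2"
    using N d by (intro mult_mono power_mono) auto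
  then show ?thesis by (simp add: D_def)
qed

lemma finite_points [simp]: "finite points"
  by (simp add: points_def star_def)

lemma pt_in_star: "pt c \<in> star c"
  by (simp add: star_def)

lemma star_subset_points: "c < k \<Longrightarrow> star c \<subseteq> points"
  by (auto simp: points_def)

lemma star_coord:
  assumes "y \<in> star c"
  obtains n where "y i = real n" "v c i \<le> n" "n \<le> v c i + 1"
proof -
  have "y i = real (v c i) \<or> y i = real (v c i + 1)"
    using assms by (auto simp: star_def pt_def)
  then show thesis
    using that[of "v c i"] that[of "v c i + 1"] by auto
qed

text \<open>At least a quarter of the coordinates of the two centers differ by \<open>N / 20\<close>
  or more, and half of that survives the shifts. Hence \<open>D\<close> is \<open>d / 4\<close>
  times the square of \<open>N / 40\<close>.\<close>

lemma sqdist_star: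
  assumes "a < k" "b < k" "a \<noteq> b" "x \<in> star a" "y \<in> star b"
  shows "D \<le> sqdist d x y"
proof -
  let ?S = "{..<d} - close_coords N d (v a) (v b)"
  have sub: "close_coords N d (v a) (v b) \<subseteq> {..<d}"
    by (auto simp: close_coords_def)
  have "card ?S + card (close_coords N d (v a) (v b)) = d"
    using sub by (metis card_Diff_subset card_lessThan card_mono finite_lessThan finite_subset le_add_diff_inverse2)
  then have cS: "real d / 4 \<le> real (card ?S)"
    using spread[OF assms(1-3)] by linarith
  have far: "(real N / 40)\<^sup>2 \<le> (x i - y i)\<^sup>2" if "i \<in> ?S" for i
  proof -
    obtain m where m: "x i = real m" "v a i \<le> m" "m \<le> v a i + 1"
      using star_coord[OF assms(4)] .
    obtain n where n: "y i = real n" "v b i \<le> n" "n \<le> v b i + 1"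
      using star_coord[OF assms(5)] .
    have "real N / 20 \<le> \<bar>real (v a i) - real (v b i)\<bar>"
      using that by (auto simp: close_coords_def)
    moreover have "real N / 40 \<ge> 1"
      using N by simp
    \<comment> \<open>Each shift is 0 or 1, so together they change the difference by at most
      1.\<close>
    moreover have "\<bar>real (v a i) - real (v b i)\<bar> \<le> \<bar>real m - real n\<bar> + 1"
      using m n by linarith
    ultimately have "real N / 40 \<le> \<bar>x i - y i\<bar>"
      unfolding m n by linarith
    then show ?thesis
      using abs_le_square_iff[of "real N / 40" "x i - y i"] by simp
  qed
  have "D = real d / 4 * (real N / 40)\<^sup>2"
    by (simp add: D_def power2_eq_square)
  also have "\<dots> \<le> real (card ?S) * (real N / 40)\<^sup>2"
    using cS by (intro mult_right_mono) auto
  also have "\<dots> = (\<Sum>i\<in>?S. (real N / 40)\<^sup>2)"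
    by simp
  also have "\<dots> \<le> (\<Sum>i\<in>?S. (x i - y i)\<^sup>2)"
    by (intro sum_mono far)
  also have "\<dots> \<le> sqdist d x y"
    unfolding sqdist_def by (intro sum_mono2) auto
  finally show ?thesis .
qed

section \<open>Fragments of stars in a leaf\<close>

lemma finite_frag [simp]: "finite (frag C)"
  by (simp add: frag_def)

lemma whole_subset_frag: "whole C \<subseteq> frag C"
  using pt_in_star by (auto simp: frag_def whole_def)

lemma finite_whole [simp]: "finite (whole C)"
  by (simp add: whole_def)

text \<open>One star per leaf is free and each further one costs \<open>D / 4\<close>. The factor
  \<open>8 / D\<close> counts every further star twice, which leaves room for the entropy
  term.\<close>

lemma leaf_bound:
  "real (card (frag C)) + trunc_xlog M (real (card (whole C))) / (4 * real N) \<le> 8 / D * cluster_cost d C + 1"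
proof -
  let ?a = "real (card (frag C))" and ?m = "real (card (whole C))"
  have "\<forall>c\<in>frag C. \<exists>y. y \<in> star c \<and> y \<in># C"
    by (auto simp: frag_def)
  then obtain r where r: "\<And>c. c \<in> frag C \<Longrightarrow> r c \<in> star c \<and> r c \<in># C"
    by metis
  have "D / 4 * (?a - 1) \<le> cluster_cost d C"
  proof (rule cluster_cost_ge)
    show "D \<le> sqdist d (r a) (r b)" if "a \<in> frag C" "b \<in> frag C" "a \<noteq> b" for a b
      using that r by (intro sqdist_star[of a b]) (auto simp: frag_def)
  qed (use r D_ge in auto)
  then have "8 / D * (D / 4 * (?a - 1)) \<le> 8 / D * cluster_cost d C"
    using D_ge by (intro mult_left_mono) auto
  then have cost: "2 * (?a - 1) \<le> 8 / D * cluster_cost d C"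
    using D_ge by simp
  \<comment> \<open>Needed for a leaf without points, where \<open>?a - 1\<close> is
    negative.\<close>
  have cost0: "0 \<le> 8 / D * cluster_cost d C"
    using D_ge cluster_cost_nonneg by simp
  have ma: "?m \<le> ?a"
    using card_mono[OF _ whole_subset_frag] by simp
  have "?a = 0 \<or> 1 \<le> ?a"
    by (cases "card (frag C)") auto
  show ?thesis
  proof (cases "M \<le> ?m")
    case False
    then show ?thesis
      using cost cost0 \<open>?a = 0 \<or> 1 \<le> ?a\<close> unfolding trunc_xlog_def by auto
  next
    case True
    have "card (whole C) \<le> k"
      using card_mono[of "{..<k}" "whole C"] by (auto simp: whole_def)
    then have "ln (?m / M) \<le> ln (real k / M)"
      using True M by (intro ln_mono divide_right_mono) auto
    then have "?m * ln (?m / M) \<le> ?m * (2 * real N)"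
      using M by (intro mult_left_mono) auto
    then have "trunc_xlog M ?m / (4 * real N) \<le> ?m / 2"
      using True N by (simp add: trunc_xlog_def field_simps)
    \<comment> \<open>Since \<open>2 \<le> m \<le> a\<close>, the entropy share \<open>m / 2\<close>
      is at most \<open>a - 1\<close>.\<close>
    moreover have "a + t \<le> K + 1"
      if "t \<le> m / 2" "2 * (a - 1) \<le> K" "m \<le> a" "M \<le> m" for a t K m :: real
      using that M(1) by auto
    ultimately show ?thesis
      using cost ma True by blast
  qed
qed

section \<open>Integer cells and the potential along a tree\<close>

lemma whole_cell: "whole (cell lo hi) = {c \<in> {..<k}. v c \<in> nat_box d lo hi}"
  using pt_in_star star_subset_points by (auto simp: whole_def cell_def nat_box_def pt_def)

lemma shift_in_cell:
  assumes "c < k" "i < d" "v c \<in> nat_box d lo hi" "v c i < hi i"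
  shows "(pt c)(i := pt c i + 1) \<in># cell lo hi"
proof -
  have "(pt c)(i := pt c i + 1) \<in> points"
    using assms star_subset_points by (auto simp: star_def)
  then show ?thesis
    using assms by (auto simp: cell_def nat_box_def pt_def)
qed

lemma points_coord:
  assumes "y \<in> points"
  shows "\<exists>n. y i = real n"
  using assms star_coord by (metis UN_E points_def)

text \<open>The data are integral, so a cut at \<open>xi\<close> acts like a cut at its floor, and
  both halves are again integer boxes. Thus the boxes of the union bound suffice for arbitrary real
  thresholds.\<close>

lemma cell_split:
  assumes "i < d" "real (lo i) \<le> xi" "xi < real (hi i)"
  defines "j \<equiv> nat \<lfloor>xi\<rfloor>"
  shows "filter_mset (\<lambda>y. y i \<le> xi) (cell lo hi) = cell lo (hi(i := j))"
    and "filter_mset (\<lambda>y. y i > xi) (cell lo hi) = cell (lo(i := Suc j)) hi"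
    and "lo i \<le> j" "j < hi i"
proof -
  show j: "lo i \<le> j" "j < hi i"
    using assms(2,3) unfolding j_def by linarith+
  have nat: "real n \<le> xi \<longleftrightarrow> n \<le> j" for n
    using assms(2) unfolding j_def by linarith
  \<comment> \<open>The cut only changes the box constraint at coordinate \<open>i\<close>.\<close>
  have cong: "(\<forall>l<d. A l) \<and> Q \<longleftrightarrow> (\<forall>l<d. B l)"
    if "\<And>l. l \<noteq> i \<Longrightarrow> A l = B l" "A i \<and> Q \<longleftrightarrow> B i" for A B Q
    using that \<open>i < d\<close> by metis
  have "(\<forall>l<d. real (lo l) \<le> y l \<and> y l \<le> real (hi l)) \<and> y i \<le> xi \<longleftrightarrow>
      (\<forall>l<d. real (lo l) \<le> y l \<and> y l \<le> real ((hi(i := j)) l))" 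
    and "(\<forall>l<d. real (lo l) \<le> y l \<and> y l \<le> real (hi l)) \<and> xi < y i \<longleftrightarrow>
      (\<forall>l<d. real ((lo(i := Suc j)) l) \<le> y l \<and> y l \<le> real (hi l))"
    if "y \<in> points" for y
  proof -
    obtain n where n: "y i = real n"
      using points_coord[OF \<open>y \<in> points\<close>] by blast
    have le: "y i \<le> xi \<longleftrightarrow> n \<le> j" "xi < y i \<longleftrightarrow> Suc j \<le> n"
      using nat[of n] n by auto
    show "(\<forall>l<d. real (lo l) \<le> y l \<and> y l \<le> real (hi l)) \<and> y i \<le> xi \<longleftrightarrow>
      (\<forall>l<d. real (lo l) \<le> y l \<and> y l \<le> real ((hi(i := j)) l))"
      by (rule cong) (use j n le in auto)
    show "(\<forall>l<d. real (lo l) \<le> y l \<and> y l \<le> real (hi l)) \<and> xi < y i \<longleftrightarrow>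
      (\<forall>l<d. real ((lo(i := Suc j)) l) \<le> y l \<and> y l \<le> real (hi l))"
      by (rule cong) (use j n le in auto)
  qed
  then show "filter_mset (\<lambda>y. y i \<le> xi) (cell lo hi) = cell lo (hi(i := j))"
    and "filter_mset (\<lambda>y. y i > xi) (cell lo hi) = cell (lo(i := Suc j)) hi"
    unfolding cell_def filter_filter_mset
    by (intro filter_mset_cong refl; simp)+
qed

text \<open>A cut at level \<open>j\<close> breaks every star whose center lies in the layer \<open>v c i = j\<close>.\<close>
lemma card_frag_split:
  assumes lohi: "lo \<in> {..<d} \<rightarrow>\<^sub>E {..N}" "hi \<in> {..<d} \<rightarrow>\<^sub>E {..N}"
    and i: "i < d" and j: "lo i \<le> j" "j < hi i"
  defines "m \<equiv> real (card (whole (cell lo hi)))"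
  shows "real (card (frag (cell lo hi))) + (if M \<le> m then m else 0) / (4 * real N)
    \<le> real (card (frag (cell lo (hi(i := j))))) + real (card (frag (cell (lo(i := Suc j)) hi)))"
proof -
  let ?C = "cell lo hi" and ?C1 = "cell lo (hi(i := j))" and ?C2 = "cell (lo(i := Suc j)) hi"
  define S where "S = {c \<in> {..<k}. v c \<in> nat_box d lo hi \<and> v c i = j}"
  have C12: "?C1 = filter_mset (\<lambda>y. y i \<le> real j) ?C" "?C2 = filter_mset (\<lambda>y. y i > real j) ?C"
    using cell_split[of i lo "real j" hi] i j by auto
  have un: "frag ?C = frag ?C1 \<union> frag ?C2"
    unfolding C12 by (fastforce simp: frag_def)
  have "S \<subseteq> frag ?C1"
  proof -
    have "S \<subseteq> whole ?C1"
      unfolding C12 using whole_cell[of lo hi] by (auto simp: whole_def S_def pt_def)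
    then show ?thesis using whole_subset_frag by blast
  qed
  \<comment> \<open>The \<open>i\<close>-th shift has coordinate \<open>j + 1\<close>, which is
    beyond the cut and still in the cell because \<open>j < hi i\<close>.\<close>
  moreover have "S \<subseteq> frag ?C2"
  proof
    fix c assume c: "c \<in> S"
    then have "(pt c)(i := pt c i + 1) \<in># ?C2"
      unfolding C12 using shift_in_cell[of c i lo hi] i j by (auto simp: S_def pt_def)
    then show "c \<in> frag ?C2"
      using c i by (auto simp: frag_def S_def star_def)
  qed
  ultimately have "card S \<le> card (frag ?C1 \<inter> frag ?C2)"
    by (intro card_mono) auto
  then have "card (frag ?C) + card S \<le> card (frag ?C1) + card (frag ?C2)"
    using card_Un_Int[of "frag ?C1" "frag ?C2"] un by simp
  then have card: "real (card (frag ?C)) + real (card S) \<le> real (card (frag ?C1)) + real (card (frag ?C2))"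
    by (simp flip: of_nat_add)
  have "(if M \<le> m then m else 0) / (4 * real N) \<le> real (card S)"
  proof (cases "M \<le> m")
    case True
    then have "m \<le> 4 * real N * real (card S)"
      using layer[OF lohi i j] unfolding m_def whole_cell S_def by simp
    then show ?thesis
      using True N by (simp add: field_simps)
  qed simp
  with card show ?thesis by linarith
qed

text \<open>Cutting a cell with \<open>m \<ge> M\<close> centers lowers the total entropy term by at
  most \<open>m / (4 * real N)\<close> and breaks at least that many stars. So \<open>\<Phi>\<close>
  of a cell is at most the sum over its two parts, and the leaves are handled by
  \<open>leaf_bound\<close>.\<close>

lemma tree_bound:
  assumes "valid_tree d T" "lo \<in> {..<d} \<rightarrow>\<^sub>E {..N}" "hi \<in> {..<d} \<rightarrow>\<^sub>E {..N}"
  defines "\<Phi> \<equiv> \<lambda>C. real (card (frag C)) + trunc_xlog M (real (card (whole C))) / (4 * real N)"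
  shows "\<Phi> (cell lo hi) \<le> 8 / D * tree_cost d (cell lo hi) T + real (num_leaves T)"
  using assms(1-3)
proof (induction T arbitrary: lo hi)
  case Leaf
  then show ?case
    using leaf_bound by (simp add: \<Phi>_def tree_cost_Leaf)
next
  case (Node i xi l r)
  let ?C = "cell lo hi"
  let ?C1 = "filter_mset (\<lambda>y. y i \<le> xi) ?C" and ?C2 = "filter_mset (\<lambda>y. y i > xi) ?C"
  let ?cost = "\<lambda>C T. 8 / D * tree_cost d C T"
  have i: "i < d" using Node.prems by simp
  have cost: "?cost ?C (Node i xi l r) = ?cost ?C1 l + ?cost ?C2 r"
    by (simp only: tree_cost_Node distrib_left)
  have cost0: "0 \<le> ?cost C T" for C T
    using D_ge tree_cost_nonneg[of d C T] by simp
  \<comment> \<open>A cut with all points on one side passes the cell on unchanged, even if its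
    threshold lies outside the box.\<close>
  consider "?C1 = {#}" | "?C2 = {#}" | "?C1 \<noteq> {#}" "?C2 \<noteq> {#}"
    by blast
  then show ?case
  proof cases
    case 1
    then have "?C2 = ?C"
      by (auto simp: filter_mset_eq_conv not_le)
    moreover have "\<Phi> ?C \<le> ?cost ?C r + real (num_leaves r)"
      by (rule Node.IH(2)) (use Node.prems in simp_all)
    ultimately show ?thesis
      unfolding cost using cost0[of ?C1 l] by simp
  next
    case 2
    then have "?C1 = ?C"
      by (auto simp: filter_mset_eq_conv not_less)
    moreover have "\<Phi> ?C \<le> ?cost ?C l + real (num_leaves l)"
      by (rule Node.IH(1)) (use Node.prems in simp_all)
    ultimately show ?thesis
      unfolding cost using cost0[of ?C2 r] by simp
  next
    case 3
    then obtain y z where "y \<in># ?C1" "z \<in># ?C2"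
      by blast
    \<comment> \<open>Points on both sides force the threshold into the range required by
      \<open>cell_split\<close>.\<close>
    then have xi: "real (lo i) \<le> xi" "xi < real (hi i)"
      using i by (force simp: cell_def)+
    define j where "j = nat \<lfloor>xi\<rfloor>"
    define lo' hi' where "lo' = lo(i := Suc j)" and "hi' = hi(i := j)"
    have C1: "?C1 = cell lo hi'" and C2: "?C2 = cell lo' hi" and j: "lo i \<le> j" "j < hi i"
      using cell_split[of i lo xi hi] i xi by (simp_all add: j_def lo'_def hi'_def)
    have "hi i \<le> N"
      using PiE_mem[OF Node.prems(3), of i] i by simp
    then have "hi' \<in> insert i {..<d} \<rightarrow>\<^sub>E {..N}" "lo' \<in> insert i {..<d} \<rightarrow>\<^sub>E {..N}"
      unfolding hi'_def lo'_def using j by (intro PiE_fun_upd Node.prems; simp)+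
    then have mem: "hi' \<in> {..<d} \<rightarrow>\<^sub>E {..N}" "lo' \<in> {..<d} \<rightarrow>\<^sub>E {..N}"
      using i by (simp_all add: insert_absorb)
    have "\<Phi> ?C1 \<le> ?cost ?C1 l + real (num_leaves l)"
      unfolding C1 by (rule Node.IH(1)) (use Node.prems mem in simp_all)
    moreover have "\<Phi> ?C2 \<le> ?cost ?C2 r + real (num_leaves r)"
      unfolding C2 by (rule Node.IH(2)) (use Node.prems mem in simp_all)
    moreover have "\<Phi> ?C \<le> \<Phi> ?C1 + \<Phi> ?C2"
    proof -
      let ?m = "\<lambda>C. real (card (whole C))"
      have "whole ?C1 \<inter> whole ?C2 = {}" "whole ?C = whole ?C1 \<union> whole ?C2"
        by (auto simp: whole_def)
      then have m: "?m ?C = ?m ?C1 + ?m ?C2"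
        by (simp only: card_Un_disjoint[OF finite_whole finite_whole] of_nat_add)
      have "trunc_xlog M (?m ?C) / (4 * real N) \<le>
          (trunc_xlog M (?m ?C1) + trunc_xlog M (?m ?C2) + (if M \<le> ?m ?C then ?m ?C else 0)) / (4 * real N)"
        unfolding m using M by (intro divide_right_mono trunc_xlog_split) auto
      moreover have "real (card (frag ?C)) + (if M \<le> ?m ?C then ?m ?C else 0) / (4 * real N)
          \<le> real (card (frag ?C1)) + real (card (frag ?C2))"
        unfolding C1 C2 lo'_def hi'_def by (rule card_frag_split[OF Node.prems(2,3) i j])
      ultimately show ?thesis
        unfolding \<Phi>_def add_divide_distrib by linarith
    qed
    ultimately show ?thesis
      unfolding cost by simp
  qed
qed

text \<open>\<open>tree_bound\<close> at the root box, which contains all stars. A tree with fewer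
  leaves than the left-hand side pays at least \<open>D / 8\<close> for each missing leaf.\<close>

lemma tree_cost_bound:
  assumes "valid_tree d T"
  shows "real k + real k * ln (real k / M) / (4 * real N)
    \<le> 8 / D * tree_cost d (mset_set points) T + real (num_leaves T)"
proof -
  \<comment> \<open>The upper corner is \<open>N\<close> and not \<open>N - 1\<close> because
    shifted points can reach \<open>N\<close>.\<close>
  define lo hi :: "nat \<Rightarrow> nat" where "lo = (\<lambda>i\<in>{..<d}. 0)" and "hi = (\<lambda>i\<in>{..<d}. N)"
  have "0 \<le> y i \<and> y i \<le> real N" if "y \<in> points" "i < d" for y i
  proof -
    obtain c where c: "c < k" "y \<in> star c"
      using \<open>y \<in> points\<close> by (auto simp: points_def)
    obtain n where "y i = real n" "n \<le> v c i + 1"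
      using star_coord[OF c(2)] .
    then show ?thesis
      using range[OF c(1) that(2)] by simp
  qed
  then have cell: "cell lo hi = mset_set points"
    unfolding cell_def lo_def hi_def by (intro filter_mset_eq_conv[THEN iffD2]) auto
  have whole: "whole (mset_set points) = {..<k}"
    using pt_in_star star_subset_points by (fastforce simp: whole_def)
  have frag: "frag (mset_set points) = {..<k}"
  proof
    show "frag (mset_set points) \<subseteq> {..<k}"
      by (auto simp: frag_def)
    show "{..<k} \<subseteq> frag (mset_set points)"
      using whole_subset_frag[of "mset_set points"] unfolding whole .
  qed
  have "lo \<in> {..<d} \<rightarrow>\<^sub>E {..N}" "hi \<in> {..<d} \<rightarrow>\<^sub>E {..N}"
    by (auto simp: lo_def hi_def)
  from tree_bound[OF assms this] show ?thesis
    unfolding cell whole frag using M(2) by (simp add: trunc_xlog_def)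
qed

section \<open>Upper bound and positivity of the optimum\<close>

lemma kmeans_cost_points:
  "(\<Sum>x\<in>#mset_set points. Min ((\<lambda>j. sqdist d x (c j)) ` {..<k}))
    = (\<Sum>x\<in>points. Min ((\<lambda>j. sqdist d x (c j)) ` {..<k}))"
  by (rule sum_unfold_sum_mset[symmetric])

lemma Min_sqdist_nonneg: "0 \<le> Min ((\<lambda>j. sqdist d x (c j)) ` {..<k})"
  using k by (subst Min_ge_iff) (auto simp: sqdist_nonneg)

text \<open>The star centers are an admissible choice, and each of the \<open>d\<close> shifts is at
  squared distance 1 from its own center.\<close>

lemma OPT_points_le: "OPT d k (mset_set points) \<le> real d * real k"
proof -
  let ?f = "\<lambda>x. Min ((\<lambda>j. sqdist d x (pt j)) ` {..<k})"
  have "OPT d k (mset_set points) \<le> (\<Sum>x\<in>points. ?f x)"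
    unfolding OPT_def kmeans_cost_points
    by (rule cInf_lower) (auto intro!: bdd_belowI[of _ 0] sum_nonneg Min_sqdist_nonneg)
  also have "\<dots> \<le> (\<Sum>c<k. \<Sum>x\<in>star c. ?f x)"
  proof -
    have "star a \<inter> star b = {}" if "a < k" "b < k" "a \<noteq> b" for a b
    proof (rule ccontr)
      assume "star a \<inter> star b \<noteq> {}"
      then obtain x where "x \<in> star a" "x \<in> star b" by blast
      then show False
        using sqdist_star[OF that, of x x] D_ge by (simp add: sqdist_def)
    qed
    then show ?thesis
      unfolding points_def by (subst sum.UNION_disjoint) (auto simp: star_def)
  qed
  also have "\<dots> \<le> (\<Sum>c<k. real d)"
  proof (rule sum_mono)
    fix c assume "c \<in> {..<k}"
    let ?s = "\<lambda>i. (pt c)(i := pt c i + 1)"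
    have "(\<Sum>x\<in>star c. ?f x) \<le> (\<Sum>x\<in>star c. sqdist d x (pt c))"
      using \<open>c \<in> {..<k}\<close> by (intro sum_mono Min_le) auto
    also have "\<dots> \<le> sqdist d (pt c) (pt c) + (\<Sum>x\<in>?s ` {..<d}. sqdist d x (pt c))"
      unfolding star_def by (subst sum.insert_if) (auto simp: sqdist_nonneg)
    also have "\<dots> \<le> (\<Sum>i<d. sqdist d (?s i) (pt c))"
      using sum_image_le[of "{..<d}" "\<lambda>x. sqdist d x (pt c)" ?s]
      by (simp add: sqdist_nonneg) (simp add: sqdist_def)
    also have "\<dots> = (\<Sum>i<d. 1)"
    proof (rule sum.cong)
      fix i assume "i \<in> {..<d}"
      then show "sqdist d (?s i) (pt c) = 1"
        by (simp add: sqdist_def if_distrib[of "\<lambda>x. (x - _)\<^sup>2"] sum.remove[of "{..<d}" i])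
    qed simp
    finally show "(\<Sum>x\<in>star c. ?f x) \<le> real d" by simp
  qed
  finally show ?thesis by (simp add: mult.commute)
qed

text \<open>Among \<open>k + 1\<close> points at pairwise squared distance at least 1/4, two share a
  nearest center and together pay at least 1/8. This excludes a final inequality that is trivial
  because the optimum is 0.\<close>

lemma OPT_points_pos: "0 < OPT d k (mset_set points)"
proof -
  let ?f = "\<lambda>c x. Min ((\<lambda>j. sqdist d x (c j)) ` {..<k})"
  \<comment> \<open>The extra point, with index \<open>k\<close>, is a shift in star 0. Its partner
    \<open>pt 0\<close> is the only other chosen point of that star, at squared distance 1.\<close>
  define q where "q c = (if c = k then (pt 0)(0 := pt 0 0 + 1) else pt c)" for c
  have q: "q c \<in> points" if "c \<le> k" for c
  proof (cases "c = k")
    case True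
    then have "q c \<in> star 0"
      using d by (auto simp: q_def star_def)
    then show ?thesis using k by (auto simp: points_def)
  next
    case False
    then show ?thesis
      using that pt_in_star[of c] star_subset_points[of c] by (auto simp: q_def)
  qed
  have sep': "1/4 \<le> sqdist d (q a) (q b)" if "a < b" "b \<le> k" for a b
  proof (cases "b = k \<and> a = 0")
    case True
    have "1 \<le> (q a 0 - q b 0)\<^sup>2"
      using True k by (simp add: q_def)
    also have "\<dots> \<le> sqdist d (q a) (q b)"
      unfolding sqdist_def using d by (intro member_le_sum) auto
    finally show ?thesis by simp
  next
    case False
    define b' where "b' = (if b = k then 0 else b)"
    have "q b \<in> star b'"
      using d by (auto simp: q_def star_def b'_def)
    moreover have "q a \<in> star a" "a \<noteq> b'" "a < k" "b' < k"
      using that False k by (auto simp: q_def star_def b'_def)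
    ultimately have "D \<le> sqdist d (q a) (q b)"
      by (intro sqdist_star[of a b'])
    then show ?thesis using D_ge by simp
  qed
  have sym: "sqdist d x y = sqdist d y x" for x y
    by (simp add: sqdist_def power2_commute)
  have sep: "1/4 \<le> sqdist d (q a) (q b)" if "a \<noteq> b" "a \<le> k" "b \<le> k" for a b
    using that sep'[of a b] sep'[of b a] sym[of "q a" "q b"] by (cases "a < b") auto
  have "1/8 \<le> (\<Sum>x\<in>points. ?f c x)" for c
  proof -
    have "\<exists>j<k. ?f c x = sqdist d x (c j)" for x
    proof -
      have "?f c x \<in> (\<lambda>j. sqdist d x (c j)) ` {..<k}"
        using k by (intro Min_in) auto
      then show ?thesis by auto
    qed
    then obtain g where g: "\<And>x. g x < k" "\<And>x. ?f c x = sqdist d x (c (g x))"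
      by metis
    have "card ((g \<circ> q) ` {..k}) \<le> card {..<k}"
      using g(1) by (intro card_mono) auto
    then have "\<not> inj_on (g \<circ> q) {..k}"
      by (intro pigeonhole) simp
    then obtain a b where ab: "a \<le> k" "b \<le> k" "a \<noteq> b" "g (q a) = g (q b)"
      by (auto simp: inj_on_def)
    have ne: "q a \<noteq> q b"
      using sep[OF ab(3,1,2)] by (auto simp: sqdist_def)
    have "1/4 \<le> 2 * ?f c (q a) + 2 * ?f c (q b)"
      using sep[OF ab(3,1,2)] sqdist_le_twice[of d "q a" "q b" "c (g (q a))"] g(2)[of "q a"] g(2)[of "q b"] ab(4)
      by simp
    moreover have "?f c (q a) + ?f c (q b) = (\<Sum>x\<in>{q a, q b}. ?f c x)"
      using ne by simp
    moreover have "\<dots> \<le> (\<Sum>x\<in>points. ?f c x)"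
      using q ab by (intro sum_mono2) (auto simp: Min_sqdist_nonneg)
    ultimately show ?thesis by linarith
  qed
  then have "1/8 \<le> OPT d k (mset_set points)"
    unfolding OPT_def kmeans_cost_points by (intro cInf_greatest) auto
  then show ?thesis by simp
qed

end

section \<open>Choice of the parameters\<close>

text \<open>The admissible range of \<open>\<delta>\<close> is empty for moderate \<open>k\<close>:
  if \<open>5 \<le> L \<le> 16\<close>, then \<open>100 * L ^ 3\<close> is at least 12500, while the
  square root of \<open>k\<close> is at most \<open>exp 8\<close>, hence at most 3^8 = 6561.\<close>

lemma ln_gt_16:
  assumes "k > 500" "ln (real k) ^ 3 / sqrt (real k) < 1/100"
  shows "ln (real k) > 16"
proof (rule ccontr)
  define L where "L = ln (real k)"
  assume "\<not> ln (real k) > 16"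
  then have L16: "L \<le> 16" by (simp add: L_def)
  have exp3: "exp (real n) \<le> 3 ^ n" for n
    using power_mono[OF exp_le, of n] by (simp add: exp_of_nat_mult[of n 1, simplified])
  have "exp 5 \<le> real k"
    using exp3[of 5] assms(1) by simp
  then have "5 \<le> L"
    using assms(1) by (simp add: L_def ln_ge_iff)
  then have "125 \<le> L ^ 3"
    using power_mono[of 5 L 3] by simp
  moreover have "L ^ 3 * 100 < exp (L / 2)"
  proof -
    have "sqrt (real k) = exp (L / 2)"
      using assms(1) by (simp add: L_def powr_half_sqrt[symmetric] powr_def)
    then show ?thesis
      using assms(2) by (simp add: L_def[symmetric] field_simps)
  qed
  moreover have "exp (L / 2) \<le> exp 8"
    using L16 by simp
  moreover have "exp (8::real) \<le> 6561"
    using exp3[of 8] by simp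
  ultimately show False
    by linarith
qed

text \<open>With \<open>k = exp L\<close>, the first term is at most
  \<open>exp (2 * L - d / 2)\<close>, where \<open>d \<ge> 5 * L\<close>. In the second,
  \<open>d\<close>, \<open>N\<close> and \<open>N + 1\<close> are at most
  \<open>exp (L / 2)\<close>, so the number of events is at most \<open>exp (L + 6 * L^2)\<close>,
  against a tail of \<open>exp (- 8 * L^2)\<close>.\<close>

lemma union_bound_small:
  fixes L :: real
  assumes k: "k > 0" and L: "L = ln (real k)" "L \<ge> 16"
    and N: "N \<ge> 1" "32 * L\<^sup>2 * real N \<le> sqrt (real k)"
    and d: "5 * L \<le> real d" "real d \<le> 6 * L"
  shows "real k ^ 2 * (1/2) ^ d +
    real d * real N * real (N + 1) ^ (2 * d) * exp (- (sqrt (real k) / (4 * real N))) < 1"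
proof -
  have kexp: "real k = exp L" "sqrt (real k) = exp (L / 2)"
    using k by (simp_all add: L powr_half_sqrt[symmetric] powr_def)
  have small: "exp (- x) < 1/2" if "x \<ge> 8" for x :: real
  proof -
    have "2 < exp x"
      using exp_ge_add_one_self[of x] that by linarith
    then show ?thesis by (simp add: exp_minus field_simps)
  qed
  have "real k ^ 2 * (1/2) ^ d = exp (2 * L - real d * ln 2)"
  proof -
    have "exp (2 * L - real d * ln 2) = exp L ^ 2 / 2 ^ d"
      by (simp add: exp_diff exp_of_nat_mult exp_double)
    then show ?thesis
      by (simp add: kexp(1) power_one_over)
  qed
  also have "\<dots> \<le> exp (- (L / 2))"
  proof -
    have "real d * (1/2) \<le> real d * ln 2"
      using ln2_ge_two_thirds by (intro mult_left_mono) auto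
    then show ?thesis using d by simp
  qed
  also have "\<dots> < 1/2"
    using L(2) by (intro small) simp
  finally have first: "real k ^ 2 * (1/2) ^ d < 1/2" .
  have "L * 16 \<le> L * L"
    using L(2) by (intro mult_left_mono) auto
  then have LL: "16 * L \<le> L\<^sup>2"
    by (simp add: power2_eq_square)
  have "32 * L\<^sup>2 * 1 \<le> 32 * L\<^sup>2 * real N"
    using N by (intro mult_left_mono) auto
  then have dk: "real d \<le> exp (L / 2)"
    using d N(2) LL L(2) unfolding kexp(2) by linarith
  have "2 * real N \<le> 32 * L\<^sup>2 * real N"
    using LL L(2) by (intro mult_right_mono) auto
  then have Nk: "real N \<le> exp (L / 2)" "real (N + 1) \<le> exp (L / 2)"
    using N unfolding kexp(2) of_nat_add by linarith+
  have "8 * L\<^sup>2 \<le> sqrt (real k) / (4 * real N)"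
    using N by (simp add: field_simps)
  then have "exp (- (sqrt (real k) / (4 * real N))) \<le> exp (- (8 * L\<^sup>2))"
    by simp
  then have "real d * real N * real (N + 1) ^ (2 * d) * exp (- (sqrt (real k) / (4 * real N)))
      \<le> exp (L / 2) * exp (L / 2) * exp (L / 2) ^ (2 * d) * exp (- (8 * L\<^sup>2))"
    using dk Nk by (intro mult_mono power_mono mult_nonneg_nonneg zero_le_power) auto
  also have "\<dots> = exp (L / 2 + L / 2 + real (2 * d) * (L / 2) + - (8 * L\<^sup>2))"
    by (simp only: exp_add exp_of_nat_mult)
  also have "\<dots> \<le> exp (- L)"
  proof -
    have "real d * L \<le> 6 * L * L"
      using d L(2) by (intro mult_right_mono) auto
    then have "real (2 * d) * (L / 2) \<le> 6 * L\<^sup>2"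
      by (simp add: power2_eq_square)
    then show ?thesis
      using LL L(2) by simp
  qed
  also have "\<dots> < 1/2"
    using L(2) by (intro small) simp
  finally show ?thesis using first by linarith
qed

theorem theorem2:
  shows "\<exists>\<gamma>::real. \<gamma> > 0 \<and>
    (\<forall>(k::nat) (\<delta>::real). k > 500 \<and> ln (real k) ^ 3 / sqrt (real k) < \<delta> \<and> \<delta> < 1/100 \<longrightarrow>
      (\<exists>(d::nat) (X::point multiset). d > 0 \<and> OPT d k X > 0 \<and>
         (\<forall>T. valid_tree d T \<and> real (num_leaves T) \<le> (1 + \<delta>) * real k \<longrightarrow>
            tree_cost d X T \<ge> \<gamma> * (ln (real k) ^ 2 / \<delta>) * OPT d k X)))"
proof (intro exI[of _ "3 / (51200 * 4096)"] conjI allI impI)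
  fix k :: nat and \<delta> :: real
  assume *: "k > 500 \<and> ln (real k) ^ 3 / sqrt (real k) < \<delta> \<and> \<delta> < 1/100"
  define L where "L = ln (real k)"
  have L: "L > 16"
    using * ln_gt_16[of k] unfolding L_def by linarith
  have k: "k > 500" and lower: "L ^ 3 / sqrt (real k) < \<delta>" and "\<delta> < 1/100"
    using * by (auto simp: L_def)
  have "0 < L ^ 3 / sqrt (real k)"
    using k L by simp
  then have "0 < \<delta>"
    using lower by linarith
  then have \<delta>: "0 < \<delta>" "\<delta> < 1/100" "L ^ 3 < \<delta> * sqrt (real k)"
    using lower \<open>\<delta> < 1/100\<close> k by (auto simp: pos_divide_less_eq)
  \<comment> \<open>Chosen so that the excess \<open>k * L / (8 * N)\<close> of fragments is at
    least \<open>4 * \<delta> * k\<close>.\<close>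
  define N where "N = nat \<lfloor>L / (32 * \<delta>)\<rfloor>"
  define d where "d = nat \<lceil>5 * L\<rceil>"
  \<comment> \<open>The bound \<open>\<delta> < 1/100\<close> with \<open>L > 16\<close> makes
    \<open>L / (32 * \<delta>)\<close> exceed 50, hence \<open>N \<ge> 40\<close>.\<close>
  have "L * (100 * \<delta>) \<le> L * 1"
    using L \<delta> by (intro mult_left_mono) auto
  then have big: "100/32 * L \<le> L / (32 * \<delta>)"
    using \<delta> by (simp add: field_simps)
  have "real_of_int \<lfloor>L / (32 * \<delta>)\<rfloor> = real N"
    using big L by (simp add: N_def)
  then have N: "real N \<le> L / (32 * \<delta>)" "L / (32 * \<delta>) - 1 < real N"
    by linarith+
  have N40: "40 \<le> N"
    using N big L by linarith
  \<comment> \<open>Rounding down loses at most a factor 2.\<close>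
  have N_ge: "L / (64 * \<delta>) \<le> real N"
  proof -
    have "L / (32 * \<delta>) = L / (64 * \<delta>) + L / (64 * \<delta>)"
      by simp
    then show ?thesis using N big L by linarith
  qed
  have N_le: "32 * \<delta> * real N \<le> L"
    using N(1) \<delta> by (simp add: field_simps)
  \<comment> \<open>The lower bound on \<open>\<delta>\<close> enters here: it keeps
    \<open>N\<close> small enough for the layer tail to beat the number of boxes.\<close>
  have Nsqrt: "32 * L\<^sup>2 * real N \<le> sqrt (real k)"
  proof -
    have "\<delta> * (32 * L\<^sup>2 * real N) = L\<^sup>2 * (32 * \<delta> * real N)"
      by simp
    also have "\<dots> \<le> L\<^sup>2 * L"
      using N_le by (intro mult_left_mono) auto
    also have "\<dots> = L ^ 3"
      by (simp add: power2_eq_square power3_eq_cube)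
    also have "\<dots> \<le> \<delta> * sqrt (real k)"
      using \<delta> by simp
    finally show ?thesis
      using \<delta> by simp
  qed
  have d: "5 * L \<le> real d" "real d \<le> 6 * L"
    using L unfolding d_def by linarith+
  have num: "real k ^ 2 * (1/2) ^ d +
      real d * real N * real (N + 1) ^ (2 * d) * exp (- (sqrt (real k) / (4 * real N))) < 1"
    by (rule union_bound_small[of k L]) (use k L L_def N40 Nsqrt d in auto)
  have "N \<ge> 10" using N40 by simp
  from ex_spread_centers[OF this num] obtain v where
    v1: "\<And>c i. c < k \<Longrightarrow> i < d \<Longrightarrow> v c i < N" and
    v2: "\<And>a b. a < k \<Longrightarrow> b < k \<Longrightarrow> a \<noteq> b \<Longrightarrow> 4 * card (close_coords N d (v a) (v b)) < 3 * d" and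
    v3: "\<And>lo hi i j. lo \<in> {..<d} \<rightarrow>\<^sub>E {..N} \<Longrightarrow> hi \<in> {..<d} \<rightarrow>\<^sub>E {..N} \<Longrightarrow> i < d \<Longrightarrow> lo i \<le> j \<Longrightarrow> j < hi i \<Longrightarrow>
       sqrt (real k) \<le> real (card {c\<in>{..<k}. v c \<in> nat_box d lo hi}) \<Longrightarrow>
       real (card {c\<in>{..<k}. v c \<in> nat_box d lo hi})
         \<le> 4 * real N * real (card {c\<in>{..<k}. v c \<in> nat_box d lo hi \<and> v c i = j})"
    by blast
  have d0: "d > 0"
    using d L by linarith
  \<comment> \<open>Stopping the entropy at \<open>M = sqrt k\<close> keeps half of the
    logarithm.\<close>
  have ln_half: "ln (real k / sqrt (real k)) = L / 2"
    using k by (simp add: real_div_sqrt ln_sqrt L_def)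
  interpret spread_centers d N k "sqrt (real k)" v
  proof
    show "2 \<le> sqrt (real k)"
      using k by (intro real_le_rsqrt) simp
    show "sqrt (real k) \<le> real k"
      using k by (intro real_le_lsqrt) (auto simp: power2_eq_square)
    show "ln (real k / sqrt (real k)) \<le> 2 * real N"
      unfolding ln_half using N big L by linarith
  qed (fact N40 d0 v1 v2 v3 | use k in simp)+
  let ?X = "mset_set points"
  have "3 / (51200 * 4096) * (ln (real k) ^ 2 / \<delta>) * OPT d k ?X \<le> tree_cost d ?X T"
    if T: "valid_tree d T" "real (num_leaves T) \<le> (1 + \<delta>) * real k" for T
  proof -
    \<comment> \<open>Of the \<open>4 * \<delta> * k\<close> excess fragments the additional leaves
      absorb at most \<open>\<delta> * k\<close>, so \<open>3 * \<delta> * k\<close> are paid for by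
      cost.\<close>
    have "real k * (4 * \<delta>) \<le> real k * (L / 2 / (4 * real N))"
      using N_le N40 by (intro mult_left_mono) (auto simp: field_simps)
    then have "real k * (3 * \<delta>) \<le> 8 / D * tree_cost d ?X T"
      using tree_cost_bound[OF T(1)] T(2) unfolding ln_half by (simp add: algebra_simps)
    then have "D / 8 * (real k * (3 * \<delta>)) \<le> D / 8 * (8 / D * tree_cost d ?X T)"
      using D_ge by (intro mult_left_mono) auto
    moreover have "D / 8 * (8 / D * tree_cost d ?X T) = tree_cost d ?X T"
      using D_ge by simp
    moreover have "D / 8 * (real k * (3 * \<delta>)) = 3 * \<delta> * (real N)\<^sup>2 / 51200 * (real d * real k)"
      by (simp add: D_def)
    ultimately have cost: "3 * \<delta> * (real N)\<^sup>2 / 51200 * (real d * real k) \<le> tree_cost d ?X T"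
      by linarith
    have "(L / (64 * \<delta>))\<^sup>2 \<le> (real N)\<^sup>2"
      using N_ge L \<delta> by (intro power_mono) auto
    then have "3 * \<delta> / 51200 * (L / (64 * \<delta>))\<^sup>2 \<le> 3 * \<delta> / 51200 * (real N)\<^sup>2"
      using \<delta> by (intro mult_left_mono) auto
    \<comment> \<open>The constant combines 51200 = 8 * 6400, from \<open>D / 8\<close>, with 4096 =
      64^2, from the lower bound on \<open>N\<close>.\<close>
    moreover have "3 / (51200 * 4096) * (L ^ 2 / \<delta>) = 3 * \<delta> / 51200 * (L / (64 * \<delta>))\<^sup>2"
      using \<delta> by (simp add: power2_eq_square field_simps)
    ultimately have "3 / (51200 * 4096) * (L ^ 2 / \<delta>) * OPT d k ?X \<le> 3 * \<delta> * (real N)\<^sup>2 / 51200 * (real d * real k)"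
      using OPT_points_le OPT_points_pos \<delta> by (intro mult_mono) auto
    then show ?thesis
      using cost by (simp add: L_def)
  qed
  then show "\<exists>(d::nat) (X::point multiset). d > 0 \<and> OPT d k X > 0 \<and>
         (\<forall>T. valid_tree d T \<and> real (num_leaves T) \<le> (1 + \<delta>) * real k \<longrightarrow>
            tree_cost d X T \<ge> 3 / (51200 * 4096) * (ln (real k) ^ 2 / \<delta>) * OPT d k X)"
    using d0 OPT_points_pos by blast
qed simp

end
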